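(* Consider a two-player zero-sum polynomial stochastic game with finite state space $\mathcal{S}=\{1,\dots,S\}$, action sets $A_1=A_2=[0,1]$, polynomial payoffs $r(s,a_1,a_2)$, polynomial transition probabilities $p(t;s,a_1,a_2)$ and discount factor $0\le\beta<1$, and let $G^s(\cdot)$ and $T:\mathbb{R}^S\to\mathbb{R}^S$ be as defined in the context. Let $\phi\in\mathbb{R}^S$ be the unique fixed point of $T$, i.e. $\phi=T\phi$. Then: (a) If for each $s\in\mathcal{S}$, $\mu(s),\nu(s)$ are optimal mixed strategies (probability measures on $[0,1]$) of players 1 and 2 for the zero-sum polynomial game with payoff $G^s(\phi)$, then $\mu=[\mu(1),\dots,\mu(S)]^T$ and $\nu=[\nu(1),\dots,\nu(S)]^T$ are optimal (equilibrium) strategies for the stochastic game. (b) If $\mathbf{v}_\beta=\mathbf{v}_\beta(\mu,\nu)$ is a value vector of the stochastic game, then $T\mathbf{v}_\beta=\mathbf{v}_\beta$. Hence the value vector exists, is unique, and equals $\phi$.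
   Context: Game. For each state $s$, $r(s,a_1,a_2)$ is a real polynomial in $(a_1,a_2)$ (reward of player 1, who maximizes; player 2 minimizes). The probability $p(t;s,a_1,a_2)$ of moving from state $s$ to $t$ is a real polynomial in $(a_1,a_2)$, with $p\ge0$ and $\sum_{t}p(t;s,a_1,a_2)=1$ for all $a_1,a_2\in[0,1]$. (No single-controller assumption is made.) Strategies. A (stationary) mixed strategy of player 1 (resp. 2) is a vector $\mu=[\mu(1),\dots,\mu(S)]$ (resp. $\nu=[\nu(1),\dots,\nu(S)]$) of Borel probability measures on $[0,1]$, one per state; the players randomize independently. Put $P(\mu,\nu)_{st}=\int\int p(t;s,a_1,a_2)\,d\mu(s)\,d\nu(s)$, $\mathbf{r}(\mu,\nu)_s=\int\int r(s,a_1,a_2)\,d\mu(s)\,d\nu(s)$ and $\mathbf{v}_\beta(\mu,\nu)=(I-\beta P(\mu,\nu))^{-1}\mathbf{r}(\mu,\nu)\in\mathbb{R}^S$, the vector of expected discounted rewards indexed by initial state. Equilibrium. A pair $\mu^0,\nu^0$ of mixed strategies is a pair of equilibrium (optimal) strategies if $\mathbf{v}_\beta(\mu,\nu^0)\le\mathbf{v}_\beta(\mu^0,\nu^0)\le\mathbf{v}_\beta(\mu^0,\nu)$ componentwise for all mixed strategies $\mu,\nu$; then $\mathbf{v}_\beta(\mu^0,\nu^0)$ is called a value vector of the game. Polynomial games. For a real polynomial $q(x,y)$, $\mathrm{val}(q)$ is the value of the zero-sum game on $[0,1]\times[0,1]$ in which player 1 chooses $x$ to maximize and player 2 chooses $y$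 to minimize $q$, with mixed strategies being Borel probability measures on $[0,1]$; a mixed saddle point is known to exist, its components are called optimal strategies, and $\mathrm{val}(q)$ is the expected payoff at a saddle point. Operator. For $\alpha\in\mathbb{R}^S$ and $s\in\mathcal{S}$, $G^s(\alpha)=r(s,a_1,a_2)+\beta\sum_{t\in\mathcal{S}}p(t;s,a_1,a_2)\alpha_t$, a polynomial in $(a_1,a_2)$; $T_s\alpha=\mathrm{val}(G^s(\alpha))$ and $T\alpha=[T_1\alpha,\dots,T_S\alpha]^T$. It is known that $T$ has a unique fixed point. *)

theory Defs
  imports "HOL-Probability.Probability" "HOL-Computational_Algebra.Polynomial"
begin

section \<open>Zero-sum polynomial games on the unit square\<close>

text \<open>
  A real polynomial \<open>q(x,y)\<close> is an element of \<open>\<real>[y][x]\<close>: the outer variable is \<open>x\<close> (the action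
  of player 1), the inner variable is \<open>y\<close> (the action of player 2).
\<close>

definition eval2 :: "real poly poly \<Rightarrow> real \<Rightarrow> real \<Rightarrow> real" where
  "eval2 q x y = poly (poly q [:x:]) y"

definition mixed_actions :: "real measure set" where
  "mixed_actions = {m. prob_space m \<and> sets m = sets (restrict_space borel {0..1::real})}"

definition mixed_ext :: "real poly poly \<Rightarrow> real measure \<Rightarrow> real measure \<Rightarrow> real" where
  "mixed_ext q m n = (\<integral>y. (\<integral>x. eval2 q x y \<partial>m) \<partial>n)"

definition saddle_point :: "real poly poly \<Rightarrow> real measure \<Rightarrow> real measure \<Rightarrow> bool" where
  "saddle_point q m n \<longleftrightarrow> m \<in> mixed_actions \<and> n \<in> mixed_actions \<and>
     (\<forall>m'\<in>mixed_actions. mixed_ext q m' n \<le> mixed_ext q m n) \<and>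
     (\<forall>n'\<in>mixed_actions. mixed_ext q m n \<le> mixed_ext q m n')"

definition optimal1 :: "real poly poly \<Rightarrow> real measure \<Rightarrow> bool" where
  "optimal1 q m \<longleftrightarrow> (\<exists>n. saddle_point q m n)"

definition optimal2 :: "real poly poly \<Rightarrow> real measure \<Rightarrow> bool" where
  "optimal2 q n \<longleftrightarrow> (\<exists>m. saddle_point q m n)"

text \<open>All saddle points of a polynomial game have the same payoff.\<close>

definition val :: "real poly poly \<Rightarrow> real" where
  "val q = (THE v. \<exists>m n. saddle_point q m n \<and> v = mixed_ext q m n)"

section \<open>Discounted polynomial stochastic games\<close>

text \<open>
  The states form a finite type \<open>'s\<close>. The reward in state \<open>s\<close> is \<open>r s\<close>, and \<open>p t s\<close> is the
  polynomial \<open>p(t; s, a\<^sub>1, a\<^sub>2)\<close>, the probability of moving from \<open>s\<close> to \<open>t\<close>.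
\<close>

definition transition_polys :: "('s::finite \<Rightarrow> 's \<Rightarrow> real poly poly) \<Rightarrow> bool" where
  "transition_polys p \<longleftrightarrow> (\<forall>s. \<forall>a1\<in>{0..1}. \<forall>a2\<in>{0..1}.
     (\<forall>t. 0 \<le> eval2 (p t s) a1 a2) \<and> (\<Sum>t\<in>UNIV. eval2 (p t s) a1 a2) = 1)"

definition mixed_strategy :: "('s::finite \<Rightarrow> real measure) \<Rightarrow> bool" where
  "mixed_strategy \<mu> \<longleftrightarrow> (\<forall>s. \<mu> s \<in> mixed_actions)"

definition transition_matrix ::
  "('s::finite \<Rightarrow> 's \<Rightarrow> real poly poly) \<Rightarrow> ('s \<Rightarrow> real measure) \<Rightarrow> ('s \<Rightarrow> real measure) \<Rightarrow> real^'s^'s"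
where
  "transition_matrix p \<mu> \<nu> = (\<chi> s t. mixed_ext (p t s) (\<mu> s) (\<nu> s))"

definition reward_vector ::
  "('s::finite \<Rightarrow> real poly poly) \<Rightarrow> ('s \<Rightarrow> real measure) \<Rightarrow> ('s \<Rightarrow> real measure) \<Rightarrow> real^'s"
where
  "reward_vector r \<mu> \<nu> = (\<chi> s. mixed_ext (r s) (\<mu> s) (\<nu> s))"

definition discounted_reward ::
  "real \<Rightarrow> ('s::finite \<Rightarrow> real poly poly) \<Rightarrow> ('s \<Rightarrow> 's \<Rightarrow> real poly poly) \<Rightarrow>
   ('s \<Rightarrow> real measure) \<Rightarrow> ('s \<Rightarrow> real measure) \<Rightarrow> real^'s"
where
  "discounted_reward \<beta> r p \<mu> \<nu> =
     matrix_inv (mat 1 - \<beta> *\<^sub>R transition_matrix p \<mu> \<nu>) *v reward_vector r \<mu> \<nu>"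

text \<open>On \<open>real^'s\<close> the order \<open>\<le>\<close> is componentwise.\<close>

definition equilibrium ::
  "real \<Rightarrow> ('s::finite \<Rightarrow> real poly poly) \<Rightarrow> ('s \<Rightarrow> 's \<Rightarrow> real poly poly) \<Rightarrow>
   ('s \<Rightarrow> real measure) \<Rightarrow> ('s \<Rightarrow> real measure) \<Rightarrow> bool"
where
  "equilibrium \<beta> r p \<mu>0 \<nu>0 \<longleftrightarrow> mixed_strategy \<mu>0 \<and> mixed_strategy \<nu>0 \<and>
     (\<forall>\<mu>. mixed_strategy \<mu> \<longrightarrow> discounted_reward \<beta> r p \<mu> \<nu>0 \<le> discounted_reward \<beta> r p \<mu>0 \<nu>0) \<and>
     (\<forall>\<nu>. mixed_strategy \<nu> \<longrightarrow> discounted_reward \<beta> r p \<mu>0 \<nu>0 \<le> discounted_reward \<beta> r p \<mu>0 \<nu>)"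

definition value_vector ::
  "real \<Rightarrow> ('s::finite \<Rightarrow> real poly poly) \<Rightarrow> ('s \<Rightarrow> 's \<Rightarrow> real poly poly) \<Rightarrow> real^'s \<Rightarrow> bool"
where
  "value_vector \<beta> r p v \<longleftrightarrow> (\<exists>\<mu> \<nu>. equilibrium \<beta> r p \<mu> \<nu> \<and> v = discounted_reward \<beta> r p \<mu> \<nu>)"

definition auxiliary_game ::
  "real \<Rightarrow> ('s::finite \<Rightarrow> real poly poly) \<Rightarrow> ('s \<Rightarrow> 's \<Rightarrow> real poly poly) \<Rightarrow>
   real^'s \<Rightarrow> 's \<Rightarrow> real poly poly"
where
  "auxiliary_game \<beta> r p \<alpha> s = r s + smult [:\<beta>:] (\<Sum>t\<in>UNIV. smult [:\<alpha> $ t:] (p t s))"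

definition shapley ::
  "real \<Rightarrow> ('s::finite \<Rightarrow> real poly poly) \<Rightarrow> ('s \<Rightarrow> 's \<Rightarrow> real poly poly) \<Rightarrow> real^'s \<Rightarrow> real^'s"
where
  "shapley \<beta> r p \<alpha> = (\<chi> s. val (auxiliary_game \<beta> r p \<alpha> s))"

end

theory Submission
  imports Defs
begin

text \<open>
  Two facts carry the result: every polynomial game on the unit square has a mixed saddle point,
  and the discounted problem is governed by a contraction.

  \<^bold>\<open>Saddle points.\<close> The payoff of a pair of mixed actions depends only on their moments, and is
  bilinear in them (\<open>mixed_ext_eq_moment_form\<close>). For mixed actions \<open>m\<close>, \<open>n\<close> put
  \<open>g(x,y) = q(x,n) - q(m,y)\<close>, the regret of the pair against the pure actions \<open>x\<close> and \<open>y\<close>. If \<open>g \<le> 0\<close>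
  on the whole square, then \<open>(m,n)\<close> is a saddle point. Following Brown and von Neumann, minimize
  the integral of \<open>(g\<^sup>+)\<^sup>2\<close> over the square. A minimizer exists because the probability measures on \<open>[0,1]\<close>
  are sequentially compact for the convergence of moments (Helly's theorem). If \<open>h = g\<^sup>+\<close> did not
  vanish at a minimizer, one could move the pair towards the two marginals \<open>m'\<close>, \<open>n'\<close> of the normalized
  density \<open>h\<close>. Since \<open>q(x,y') - q(x',y)\<close> is antisymmetric under exchanging \<open>(x,y)\<close> with
  \<open>(x',y')\<close>, the integral of \<open>h\<close> times the regret of \<open>(m',n')\<close> is zero, so the objective
  has the derivative \<open>-2\<integral>h\<^sup>2 < 0\<close> in this direction, a contradiction
  (\<open>regret_of_minimizer_nonpos\<close>).

  \<^bold>\<open>The Shapley operator.\<close> The value of a polynomial game is monotone in the payoff and moves by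
  at most \<open>e\<close> if the payoff does (\<open>val_le_add\<close>). As the transition probabilities sum to one, the operator contracts the
  supremum norm by \<open>\<beta>\<close>, and so has a unique fixed point \<open>\<phi>\<close>.

  \<^bold>\<open>The stochastic game.\<close> For fixed strategies the discounted reward is the only solution of
  \<open>v = r + \<beta>Pv\<close>, and a maximum principle for stochastic matrices shows that it dominates every
  \<open>u\<close> with \<open>u \<le> r + \<beta>Pu\<close> and is dominated by every \<open>u\<close> with the opposite inequality
  (\<open>le_discounted_reward\<close>, \<open>discounted_reward_le\<close>). The right-hand side at \<open>s\<close> is the payoff of the
  auxiliary game with parameter \<open>u\<close>. So saddle points of the games \<open>G\<^sup>s(\<phi>)\<close> give strategies with reward
  \<open>\<phi>\<close> from which no deviation is profitable. Conversely, if in an equilibrium with reward \<open>v\<close> some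
  player could gain in the game \<open>G\<^sup>s(v)\<close> at a single state \<open>s\<close>, then deviating at \<open>s\<close> alone would be
  profitable in the stochastic game. Hence the local strategies form saddle points of the games \<open>G\<^sup>s(v)\<close>, and \<open>v\<close> is
  a fixed point.
\<close>

section \<open>Moments of mixed actions\<close>

definition moment :: "real measure \<Rightarrow> nat \<Rightarrow> real" where
  "moment m i = (\<integral>x. x ^ i \<partial>m)"

text \<open>
  The bilinear form on sequences whose matrix is the coefficient matrix of \<open>q\<close>. Applied to powers
  of a number or to moments of a measure in either slot, it expresses all pure, half-mixed and mixed payoffs at once.
\<close>
definition moment_form :: "real poly poly \<Rightarrow> (nat \<Rightarrow> real) \<Rightarrow> (nat \<Rightarrow> real) \<Rightarrow> real" where
  "moment_form q u w =
     (\<Sum>i\<le>degree q. \<Sum>j\<le>degree (coeff q i). coeff (coeff q i) j * (u i * w j))"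

lemma eval2_eq_moment_form: "eval2 q x y = moment_form q (power x) (power y)"
proof -
  have "eval2 q x y = (\<Sum>i\<le>degree q. poly (coeff q i) y * x ^ i)"
    by (simp add: eval2_def poly_altdef[of q] poly_sum poly_power)
  also have "\<dots> = (\<Sum>i\<le>degree q. (\<Sum>j\<le>degree (coeff q i). coeff (coeff q i) j * y ^ j) * x ^ i)"
    by (simp only: poly_altdef)
  finally show ?thesis
    by (simp add: moment_form_def sum_distrib_left sum_distrib_right mult_ac)
qed

lemma moment_form_convex_left:
  "moment_form q (\<lambda>i. (1 - t) * u i + t * u' i) w
     = (1 - t) * moment_form q u w + t * moment_form q u' w"
  by (simp add: moment_form_def sum_distrib_left sum.distrib[symmetric] algebra_simps)

lemma moment_form_convex_right:
  "moment_form q u (\<lambda>j. (1 - t) * w j + t * w' j)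
     = (1 - t) * moment_form q u w + t * moment_form q u w'"
  by (simp add: moment_form_def sum_distrib_left sum.distrib[symmetric] algebra_simps)

lemma mixed_actions_prob_space: "m \<in> mixed_actions \<Longrightarrow> prob_space m"
  and mixed_actions_sets: "m \<in> mixed_actions \<Longrightarrow> sets m = sets (restrict_space borel {0..1})"
  by (auto simp: mixed_actions_def)

lemma mixed_actions_space: "m \<in> mixed_actions \<Longrightarrow> space m = {0..1}"
  using sets_eq_imp_space_eq[OF mixed_actions_sets] by (simp add: space_restrict_space)

lemma integrable_mixed_action:
  fixes f :: "real \<Rightarrow> real"
  assumes m: "m \<in> mixed_actions" and f: "continuous_on {0..1} f"
  shows "integrable m f"
proof -
  interpret prob_space m using m by (rule mixed_actions_prob_space)
  have "f \<in> borel_measurable (restrict_space borel {0..1})"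
    using f by (rule borel_measurable_continuous_on_restrict)
  then have meas: "f \<in> borel_measurable m"
    using measurable_cong_sets[OF mixed_actions_sets[OF m] refl] by blast
  have "bounded (f ` {0..1})"
    using f by (intro compact_imp_bounded compact_continuous_image) auto
  then obtain B where B: "\<And>x. x \<in> {0..1} \<Longrightarrow> norm (f x) \<le> B"
    unfolding bounded_iff by blast
  show ?thesis
    by (rule integrable_const_bound[where B = B])
       (use B meas in \<open>auto intro!: AE_I2 simp: mixed_actions_space[OF m]\<close>)
qed

lemma integrable_power_mixed_action [simp]:
  "m \<in> mixed_actions \<Longrightarrow> integrable m (\<lambda>x. x ^ i)"
  by (intro integrable_mixed_action continuous_intros)

lemma moment_in_unit: "m \<in> mixed_actions \<Longrightarrow> moment m i \<in> {0..1}"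
proof -
  assume m: "m \<in> mixed_actions"
  interpret prob_space m using m by (rule mixed_actions_prob_space)
  have "0 \<le> (\<integral>x. x ^ i \<partial>m)"
    by (rule integral_nonneg_AE, rule AE_I2) (auto simp: mixed_actions_space[OF m])
  moreover have "(\<integral>x. x ^ i \<partial>m) \<le> 1"
    by (rule integral_le_const)
       (use m in \<open>auto intro!: AE_I2 power_le_one simp: mixed_actions_space\<close>)
  ultimately show ?thesis by (simp add: moment_def)
qed

lemma integral_moment_form_left:
  assumes "m \<in> mixed_actions"
  shows "(\<integral>x. moment_form q (power x) w \<partial>m) = moment_form q (moment m) w"
  using assms by (simp add: moment_form_def moment_def)

lemma integral_moment_form_right:
  assumes "m \<in> mixed_actions"
  shows "(\<integral>y. moment_form q u (power y) \<partial>m) = moment_form q u (moment m)"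
  using assms by (simp add: moment_form_def moment_def)

lemma continuous_on_moment_form:
  fixes f g :: "'a::topological_space \<Rightarrow> nat \<Rightarrow> real"
  assumes "\<And>i. continuous_on S (\<lambda>x. f x i)" "\<And>i. continuous_on S (\<lambda>x. g x i)"
  shows "continuous_on S (\<lambda>x. moment_form q (f x) (g x))"
  unfolding moment_form_def by (intro continuous_intros assms)

lemma mixed_ext_eq_moment_form:
  assumes "m \<in> mixed_actions" "n \<in> mixed_actions"
  shows "mixed_ext q m n = moment_form q (moment m) (moment n)"
  using assms
  by (simp add: mixed_ext_def eval2_eq_moment_form integral_moment_form_left integral_moment_form_right)

text \<open>
  Both sides of an inequality between pure actions may be averaged independently, because \<open>x\<close>
  occurs on the left only and \<open>y\<close> on the right only.
\<close>
lemma mixed_ext_le_of_pure_le: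
  assumes m: "m \<in> mixed_actions" and n: "n \<in> mixed_actions"
    and m': "m' \<in> mixed_actions" and n': "n' \<in> mixed_actions"
    and le: "\<And>x y. x \<in> {0..1} \<Longrightarrow> y \<in> {0..1} \<Longrightarrow>
           moment_form q (power x) (moment n) \<le> moment_form q (moment m) (power y)"
  shows "mixed_ext q m' n \<le> mixed_ext q m n'"
proof -
  interpret m': prob_space m' using m' by (rule mixed_actions_prob_space)
  interpret n': prob_space n' using n' by (rule mixed_actions_prob_space)
  have 1: "moment_form q (moment m') (moment n) \<le> moment_form q (moment m) (power y)"
    if "y \<in> {0..1}" for y
    unfolding integral_moment_form_left[OF m', symmetric]
    by (rule m'.integral_le_const)
       (use that le m' in \<open>auto intro!: AE_I2 integrable_mixed_action continuous_on_moment_form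
          continuous_intros simp: mixed_actions_space\<close>)
  have "moment_form q (moment m') (moment n) \<le> moment_form q (moment m) (moment n')"
    unfolding integral_moment_form_right[OF n', of q "moment m", symmetric]
    by (rule n'.integral_ge_const)
       (use 1 n' in \<open>auto intro!: AE_I2 integrable_mixed_action continuous_on_moment_form
          continuous_intros simp: mixed_actions_space\<close>)
  then show ?thesis
    using assms by (simp add: mixed_ext_eq_moment_form)
qed

lemma saddle_pointI:
  assumes "m \<in> mixed_actions" "n \<in> mixed_actions"
    and "\<And>x y. x \<in> {0..1} \<Longrightarrow> y \<in> {0..1} \<Longrightarrow>
           moment_form q (power x) (moment n) \<le> moment_form q (moment m) (power y)"
  shows "saddle_point q m n"
  unfolding saddle_point_def
  using mixed_ext_le_of_pure_le[OF assms(1,2) _ _ assms(3)] assms(1,2) by blast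

text \<open>
  The mixture is obtained by first drawing which of the two measures to use. It makes the set of
  moment sequences convex, which is all that the descent argument needs.
\<close>
lemma mixture_moments:
  assumes m: "m \<in> mixed_actions" and m': "m' \<in> mixed_actions" and t: "0 \<le> t" "t \<le> 1"
  obtains k where "k \<in> mixed_actions"
    "\<And>i. moment k i = (1 - t) * moment m i + t * moment m' i"
proof -
  define I where "I = restrict_space borel {0..1::real}"
  define K where "K = (\<lambda>b. if b then m' else m)"
  define k where "k = measure_pmf (bernoulli_pmf t) \<bind> K"
  have K: "K \<in> measurable (measure_pmf (bernoulli_pmf t)) (subprob_algebra I)"
    using m m' by (auto simp: K_def I_def space_subprob_algebra mixed_actions_def split: if_splits
        intro!: prob_space_imp_subprob_space)
  have KP: "K \<in> measurable (measure_pmf (bernoulli_pmf t)) (prob_algebra I)"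
    using m m' by (auto simp: K_def I_def space_prob_algebra mixed_actions_def split: if_splits)
  have "sets k = sets I" unfolding k_def
    using K by (rule sets_bind[OF sets_kernel]) (auto)
  moreover have "prob_space k" unfolding k_def
    by (rule prob_space_bind'[OF _ KP]) (simp add: space_prob_algebra measure_pmf.prob_space_axioms)
  ultimately have k: "k \<in> mixed_actions" by (simp add: mixed_actions_def I_def)
  have nn: "ennreal (moment n i) = (\<integral>\<^sup>+x. ennreal (x ^ i) \<partial>n)" if "n \<in> mixed_actions" for n i
    unfolding moment_def
    by (rule nn_integral_eq_integral[symmetric]) (use that in \<open>auto intro!: AE_I2 simp: mixed_actions_space\<close>)
  have "moment k i = (1 - t) * moment m i + t * moment m' i" for i
  proof -
    have "ennreal (moment k i) = (\<integral>\<^sup>+x. ennreal (x ^ i) \<partial>k)"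
      by (rule nn[OF k])
    also have "\<dots> = (\<integral>\<^sup>+b. \<integral>\<^sup>+x. ennreal (x ^ i) \<partial>K b \<partial>measure_pmf (bernoulli_pmf t))"
      unfolding k_def
      by (rule nn_integral_bind[OF _ K]) (auto simp: I_def intro!: measurable_restrict_space1)
    also have "\<dots> = ennreal (moment m' i) * t + ennreal (moment m i) * (1 - t)"
      using t by (simp add: K_def nn[OF m] nn[OF m'])
    also have "\<dots> = ennreal (moment m' i * t + moment m i * (1 - t))"
      using t moment_in_unit[OF m, of i] moment_in_unit[OF m', of i]
      by (subst ennreal_plus) (auto simp: ennreal_mult)
    finally show ?thesis
      using t moment_in_unit[OF m, of i] moment_in_unit[OF m', of i] moment_in_unit[OF k, of i]
      by (subst (asm) ennreal_inj) (auto simp: mult_ac)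
  qed
  with k that show ?thesis by blast
qed

section \<open>Existence of a mixed saddle point\<close>

text \<open>
  Pushed forward to the real line, the measures are tight, so Helly's selection theorem yields a
  weak limit. Moments are integrals of bounded continuous functions once \<open>x\<close> is clipped to \<open>[0,1]\<close>,
  and therefore converge.
\<close>
lemma mixed_actions_sequentially_compact:
  assumes m: "\<And>k::nat. m k \<in> mixed_actions"
  obtains r l where "strict_mono (r :: nat \<Rightarrow> nat)" "l \<in> mixed_actions"
    "\<And>i. (\<lambda>k. moment (m (r k)) i) \<longlonglongrightarrow> moment l i"
proof -
  define M where "M k = distr (m k) borel (\<lambda>x. x)" for k
  have id: "(\<lambda>x. x) \<in> measurable (m k) borel" for k
    using measurable_cong_sets[OF mixed_actions_sets[OF m] refl] 
    by (metis measurable_ident_sets measurable_restrict_space1 sets_borel)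
  have integral_M: "(\<integral>x. f x \<partial>M k) = (\<integral>x. f x \<partial>m k)" if "continuous_on UNIV f" for f :: "real \<Rightarrow> real" and k
    unfolding M_def by (rule integral_distr[OF id]) (rule borel_measurable_continuous_onI[OF that])
  have rd: "real_distribution (M k)" for k
  proof -
    interpret prob_space "m k" using m by (rule mixed_actions_prob_space)
    have "prob_space (M k)" unfolding M_def using id by (rule prob_space_distr)
    then show ?thesis by (simp add: real_distribution_def real_distribution_axioms_def M_def)
  qed
  have one: "measure (M k) {-1<..1} = 1" for k
  proof -
    interpret prob_space "m k" using m by (rule mixed_actions_prob_space)
    have "measure (M k) {-1<..1} = measure (m k) ({-1<..1} \<inter> space (m k))"
      unfolding M_def by (subst measure_distr[OF id]) auto
    also have "{-1<..1} \<inter> space (m k) = space (m k)"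
      by (auto simp: mixed_actions_space[OF m])
    finally show ?thesis by (simp add: prob_space)
  qed
  have "tight M"
    unfolding tight_def
  proof (intro conjI allI impI rd)
    fix e :: real assume "0 < e"
    then show "\<exists>a b. a < b \<and> (\<forall>k. 1 - e < measure (M k) {a<..b})"
      using one by (intro exI[of _ "-1"] exI[of _ 1]) auto
  qed
  from tight_imp_convergent_subsubsequence[OF this strict_mono_id]
  obtain r L where r: "strict_mono r" and L: "real_distribution L" and wc: "weak_conv_m (M \<circ> r) L"
    by auto
  interpret L: real_distribution L by fact
  have conv: "(\<lambda>k. \<integral>x. f x \<partial>m (r k)) \<longlonglongrightarrow> (\<integral>x. f x \<partial>L)"
    if f: "continuous_on UNIV f" and B: "\<And>x. \<bar>f x\<bar> \<le> B" for f :: "real \<Rightarrow> real" and B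
  proof -
    have "(\<lambda>k. integral\<^sup>L (M (r k)) f) \<longlonglongrightarrow> integral\<^sup>L L f"
    proof (rule weak_conv_imp_integral_bdd_continuous_conv)
      show "isCont f x" for x using f continuous_on_eq_continuous_at by blast
      show "norm (f x) \<le> B" for x using B by simp
    qed (use rd wc L in \<open>auto simp: o_def\<close>)
    then show ?thesis using integral_M[OF f] by simp
  qed
  \<comment> \<open>The truncated distance to \<open>[0,1]\<close> has integral zero along the sequence, hence also in the
    limit: the limit measure does not leave the interval.\<close>
  define d where "d x = min 1 (max 0 (- x) + max 0 (x - 1))" for x :: real
  have d_cont: "continuous_on UNIV d"
    unfolding d_def by (intro continuous_intros)
  have [measurable]: "d \<in> borel_measurable borel"
    using d_cont by (rule borel_measurable_continuous_onI)
  have "(\<integral>x. d x \<partial>m (r k)) = (\<integral>x. 0 \<partial>m (r k))" for k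
    by (rule Bochner_Integration.integral_cong) (auto simp: d_def mixed_actions_space[OF m])
  moreover have "(\<lambda>k. \<integral>x. d x \<partial>m (r k)) \<longlonglongrightarrow> (\<integral>x. d x \<partial>L)"
    by (rule conv[of _ 1, OF d_cont]) (auto simp: d_def)
  ultimately have d0: "(\<integral>x. d x \<partial>L) = 0"
    by (simp add: LIMSEQ_const_iff)
  have "integrable L d"
    by (rule L.integrable_const_bound[where B = 1]) (auto simp: d_def)
  then have "AE x in L. d x = 0"
    using d0 by (subst (asm) integral_nonneg_eq_0_iff_AE) (auto simp: d_def)
  then have AE: "AE x in L. x \<in> {0..1}"
    by eventually_elim (auto simp: d_def min_def max_def split: if_splits)
  define l where "l = restrict_space L {0..1}"
  have sl: "sets l = sets (restrict_space borel {0..1})"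
    unfolding l_def by (rule sets_restrict_space_cong) simp
  have "emeasure L {0..1} = 1"
    using L.prob_eq_1[of "{0..1}"] AE by (simp add: L.emeasure_eq_measure)
  then have "prob_space l"
    unfolding l_def by (intro prob_space_restrict_space) auto
  with sl have l: "l \<in> mixed_actions" by (simp add: mixed_actions_def)
  have "(\<lambda>k. moment (m (r k)) i) \<longlonglongrightarrow> moment l i" for i
  proof -
    define f where "f x = (min 1 (max 0 x)) ^ i" for x :: real
    have f_cont: "continuous_on UNIV f"
      unfolding f_def by (intro continuous_intros)
    have [measurable]: "f \<in> borel_measurable borel"
      using f_cont by (rule borel_measurable_continuous_onI)
    have "moment (m (r k)) i = (\<integral>x. f x \<partial>m (r k))" for k
      unfolding moment_def
      by (rule Bochner_Integration.integral_cong) (auto simp: f_def mixed_actions_space[OF m])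
    moreover have "moment l i = (\<integral>x. f x \<partial>L)"
    proof -
      have "moment l i = (\<integral>x. indicator {0..1} x *\<^sub>R x ^ i \<partial>L)"
        unfolding moment_def l_def by (rule integral_restrict_space) auto
      also have "\<dots> = (\<integral>x. f x \<partial>L)"
      proof (rule integral_cong_AE)
        show "AE x in L. indicator {0..1} x *\<^sub>R x ^ i = f x"
          using AE by eventually_elim (auto simp: f_def)
      qed simp_all
      finally show ?thesis .
    qed
    moreover have "(\<lambda>k. \<integral>x. f x \<partial>m (r k)) \<longlonglongrightarrow> (\<integral>x. f x \<partial>L)"
      by (rule conv[of _ 1, OF f_cont])
         (auto simp: f_def power_abs intro!: power_le_one)
    ultimately show ?thesis by simp
  qed
  with r l that show ?thesis by blast
qed

definition regret :: "real poly poly \<Rightarrow> real measure \<Rightarrow> real measure \<Rightarrow> real \<times> real \<Rightarrow> real" where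
  "regret q m n z = moment_form q (power (fst z)) (moment n) - moment_form q (moment m) (power (snd z))"

definition square :: "(real \<times> real) measure" where
  "square = restrict_space lborel ({0..1} \<times> {0..1})"

text \<open>
  The objective of the minimization. Squaring the positive part makes it differentiable.
\<close>
definition total_regret :: "real poly poly \<Rightarrow> real measure \<Rightarrow> real measure \<Rightarrow> real" where
  "total_regret q m n = (\<integral>z. (max 0 (regret q m n z))\<^sup>2 \<partial>square)"

lemma space_square: "space square = {0..1} \<times> {0..1}"
  by (simp add: square_def space_restrict_space)

lemma integrable_square_iff:
  "integrable square f \<longleftrightarrow> integrable lborel (\<lambda>z. indicator ({0..1} \<times> {0..1}) z *\<^sub>R f z)"
  for f :: "real \<times> real \<Rightarrow> real"
  unfolding square_def by (rule integrable_restrict_space) (simp add: borel_Times)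

lemma integrable_square:
  fixes f :: "real \<times> real \<Rightarrow> real"
  assumes "continuous_on UNIV f"
  shows "integrable square f"
  unfolding integrable_square_iff
  by (rule borel_integrable_compact)
     (auto intro!: compact_Times continuous_on_subset[OF assms])

text \<open>
  Turns the vanishing of the minimum, an integral, into an inequality at every point of the square.
\<close>
lemma square_integral_zero_imp_zero:
  fixes f :: "real \<times> real \<Rightarrow> real"
  assumes f: "continuous_on UNIV f" "\<And>z. 0 \<le> f z" and 0: "(\<integral>z. f z \<partial>square) = 0"
    and z: "z \<in> {0..1} \<times> {0..1}"
  shows "f z = 0"
proof -
  have "(\<integral>z. f z \<partial>square) = (\<integral>z. indicator ({0..1} \<times> {0..1}) z *\<^sub>R f z \<partial>lborel)"
    unfolding square_def by (rule integral_restrict_space) (simp add: borel_Times)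
  then have "((\<lambda>z. indicator ({0..1} \<times> {0..1}) z *\<^sub>R f z) has_integral 0) UNIV"
    using has_integral_integral_lborel[of "\<lambda>z. indicator ({0..1} \<times> {0..1}) z *\<^sub>R f z"]
      integrable_square[OF f(1)] 0 by (simp add: integrable_square_iff)
  then have "((\<lambda>z. if z \<in> cbox (0, 0) (1, 1) then f z else 0) has_integral 0) UNIV"
    by (rule has_integral_eq[rotated]) (auto simp: cbox_Pair_eq indicator_def)
  then have "(f has_integral 0) (cbox (0, 0) (1, 1))"
    by (simp only: has_integral_restrict_UNIV)
  then show ?thesis
    by (rule has_integral_0_cbox_imp_0[rotated 2])
       (use f z in \<open>auto intro: continuous_on_subset simp: cbox_Pair_eq box_ne_empty Basis_prod_def\<close>)
qed

lemma continuous_on_regret: "continuous_on S (regret q m n)"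
  unfolding regret_def
  by (intro continuous_intros continuous_on_moment_form) 

text \<open>
  Supplies a constant dominating function for passing to the limit under the integral.
\<close>
lemma abs_moment_form_le:
  assumes "\<And>i. \<bar>u i\<bar> \<le> 1" "\<And>j. \<bar>w j\<bar> \<le> 1"
  shows "\<bar>moment_form q u w\<bar>
    \<le> (\<Sum>i\<le>degree q. \<Sum>j\<le>degree (coeff q i). \<bar>coeff (coeff q i) j\<bar>)"
proof -
  have "\<bar>coeff (coeff q i) j * (u i * w j)\<bar> \<le> \<bar>coeff (coeff q i) j\<bar>" for i j
  proof -
    have "\<bar>u i\<bar> * \<bar>w j\<bar> \<le> 1 * 1" by (rule mult_mono) (auto simp: assms)
    from mult_left_mono[OF this, of "\<bar>coeff (coeff q i) j\<bar>"] show ?thesis by (simp add: abs_mult)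
  qed
  then show ?thesis
    unfolding moment_form_def by (intro order_trans[OF sum_abs] sum_mono) 
qed

lemma total_regret_tendsto:
  assumes m: "\<And>k::nat. m k \<in> mixed_actions" and n: "\<And>k. n k \<in> mixed_actions"
    and m': "\<And>i. (\<lambda>k. moment (m k) i) \<longlonglongrightarrow> moment m' i"
    and n': "\<And>i. (\<lambda>k. moment (n k) i) \<longlonglongrightarrow> moment n' i"
  shows "(\<lambda>k. total_regret q (m k) (n k)) \<longlonglongrightarrow> total_regret q m' n'"
  unfolding total_regret_def
proof (rule integral_dominated_convergence)
  define C where "C = (\<Sum>i\<le>degree q. \<Sum>j\<le>degree (coeff q i). \<bar>coeff (coeff q i) j\<bar>)"
  show "integrable square (\<lambda>z. (C + C)\<^sup>2)"
    by (rule integrable_square) simp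
  show "AE z in square. norm ((max 0 (regret q (m k) (n k) z))\<^sup>2) \<le> (C + C)\<^sup>2" for k
  proof (rule AE_I2)
    fix z assume "z \<in> space square"
    then have z: "fst z \<in> {0..1}" "snd z \<in> {0..1}" by (auto simp: space_square)
    have "\<bar>moment_form q (power (fst z)) (moment (n k))\<bar> \<le> C"
      "\<bar>moment_form q (moment (m k)) (power (snd z))\<bar> \<le> C"
      unfolding C_def
      by (rule abs_moment_form_le; use z moment_in_unit[OF m] moment_in_unit[OF n] in
          \<open>auto simp: power_abs intro!: power_le_one\<close>)+
    then have "\<bar>max 0 (regret q (m k) (n k) z)\<bar> \<le> \<bar>C + C\<bar>"
      by (simp add: regret_def)
    then show "norm ((max 0 (regret q (m k) (n k) z))\<^sup>2) \<le> (C + C)\<^sup>2"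
      by (simp only: abs_le_square_iff real_norm_def abs_power2)
  qed
  show "AE z in square. (\<lambda>k. (max 0 (regret q (m k) (n k) z))\<^sup>2) \<longlonglongrightarrow> (max 0 (regret q m' n' z))\<^sup>2"
    unfolding regret_def moment_form_def by (intro AE_I2 tendsto_intros m' n')
qed (auto intro!: borel_measurable_integrable integrable_square continuous_intros continuous_on_regret)

text \<open>
  The total regret is continuous for the convergence of moments, and pairs of mixed actions are
  sequentially compact for it, one player after the other.
\<close>
lemma total_regret_has_minimum:
  obtains m n where "m \<in> mixed_actions" "n \<in> mixed_actions"
    "\<And>m' n'. m' \<in> mixed_actions \<Longrightarrow> n' \<in> mixed_actions \<Longrightarrow> total_regret q m n \<le> total_regret q m' n'"
proof -
  define V where "V = (\<lambda>(m, n). total_regret q m n) ` (mixed_actions \<times> mixed_actions)"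
  have "return (restrict_space borel {0..1}) 0 \<in> mixed_actions"
    by (auto simp: mixed_actions_def space_restrict_space intro!: prob_space_return)
  then have ne: "V \<noteq> {}" by (auto simp: V_def)
  have bdd: "bdd_below V"
    by (rule bdd_belowI[of _ 0]) (auto simp: V_def total_regret_def)
  have "\<exists>m n. m \<in> mixed_actions \<and> n \<in> mixed_actions \<and> total_regret q m n < Inf V + 1 / Suc k" for k
    using cInf_lessD[OF ne, of "Inf V + 1 / Suc k"] by (auto simp: V_def)
  then obtain m n where mn: "\<And>k. m k \<in> mixed_actions" "\<And>k. n k \<in> mixed_actions"
    "\<And>k. total_regret q (m k) (n k) < Inf V + 1 / Suc k"
    by metis
  obtain r1 m' where r1: "strict_mono (r1 :: nat \<Rightarrow> nat)" and m': "m' \<in> mixed_actions"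
    and lim1: "\<And>i. (\<lambda>k. moment (m (r1 k)) i) \<longlonglongrightarrow> moment m' i"
    by (rule mixed_actions_sequentially_compact[of m, OF mn(1)]) (rule that)
  obtain r2 n' where r2: "strict_mono (r2 :: nat \<Rightarrow> nat)" and n': "n' \<in> mixed_actions"
    and lim2: "\<And>i. (\<lambda>k. moment (n (r1 (r2 k))) i) \<longlonglongrightarrow> moment n' i"
    by (rule mixed_actions_sequentially_compact[of "\<lambda>k. n (r1 k)", OF mn(2)]) (rule that)
  have "(\<lambda>k. total_regret q (m (r1 (r2 k))) (n (r1 (r2 k)))) \<longlonglongrightarrow> total_regret q m' n'"
    using mn LIMSEQ_subseq_LIMSEQ[OF lim1 r2] lim2
    by (intro total_regret_tendsto) (auto simp: o_def)
  moreover have "(\<lambda>k. Inf V + 1 / Suc k) \<longlonglongrightarrow> Inf V"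
    using tendsto_add[OF tendsto_const LIMSEQ_inverse_real_of_nat, of "Inf V"]
    by (simp add: inverse_eq_divide)
  from LIMSEQ_subseq_LIMSEQ[OF this strict_mono_o[OF r1 r2]]
  have "(\<lambda>k. Inf V + 1 / Suc (r1 (r2 k))) \<longlonglongrightarrow> Inf V"
    by (simp add: o_def)
  ultimately have "total_regret q m' n' \<le> Inf V"
    by (rule LIMSEQ_le) (use mn(3) in \<open>auto intro: less_imp_le\<close>)
  moreover have "Inf V \<le> total_regret q m'' n''" if "m'' \<in> mixed_actions" "n'' \<in> mixed_actions" for m'' n''
    using that by (intro cInf_lower bdd) (auto simp: V_def)
  ultimately show ?thesis using that m' n' by (meson order_trans)
qed

text \<open>
  The direction of descent: draw a point of the square with density proportional to \<open>h\<close> and project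
  it to the axes. The normalizing constant is kept on the left so that no division occurs later.
\<close>
lemma density_marginals:
  fixes h :: "real \<times> real \<Rightarrow> real"
  assumes h: "continuous_on UNIV h" "\<And>z. 0 \<le> h z" and pos: "0 < (\<integral>z. h z \<partial>square)"
  obtains m n where "m \<in> mixed_actions" "n \<in> mixed_actions"
    "\<And>i. (\<integral>z. h z \<partial>square) * moment m i = (\<integral>z. h z * fst z ^ i \<partial>square)"
    "\<And>i. (\<integral>z. h z \<partial>square) * moment n i = (\<integral>z. h z * snd z ^ i \<partial>square)"
proof -
  define c where "c = (\<integral>z. h z \<partial>square)"
  have c: "0 < c" using pos by (simp add: c_def)
  define D where "D = density square (\<lambda>z. ennreal (h z / c))"
  have hm: "(\<lambda>z. h z / c) \<in> borel_measurable square"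
    using h c by (auto intro!: borel_measurable_integrable integrable_square continuous_intros)
  have "(\<integral>\<^sup>+z. ennreal (h z / c) \<partial>square) = ennreal (\<integral>z. h z / c \<partial>square)"
    using h c by (intro nn_integral_eq_integral) (auto intro!: integrable_square continuous_intros)
  also have "\<dots> = 1" using c by (simp add: c_def[symmetric])
  finally have D: "prob_space D"
    using hm by (intro prob_spaceI) (simp add: D_def emeasure_density cong: nn_integral_cong)
  have marginal: "distr D (restrict_space borel {0..1}) f \<in> mixed_actions \<and>
      c * moment (distr D (restrict_space borel {0..1}) f) i = (\<integral>z. h z * f z ^ i \<partial>square)"
    if f: "continuous_on UNIV f" "\<And>z. z \<in> {0..1} \<times> {0..1} \<Longrightarrow> f z \<in> {0..1}"
    for f :: "real \<times> real \<Rightarrow> real" and i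
  proof -
    have fm: "f \<in> measurable D (restrict_space borel {0..1})"
      using f by (auto simp: D_def space_square intro!: measurable_restrict_space2
          borel_measurable_integrable integrable_square)
    have "moment (distr D (restrict_space borel {0..1}) f) i = (\<integral>z. f z ^ i \<partial>D)"
      unfolding moment_def
      by (rule integral_distr[OF fm]) (auto intro!: measurable_restrict_space1)
    also have "\<dots> = (\<integral>z. (h z / c) * f z ^ i \<partial>square)"
      unfolding D_def using h c f(1)
      by (subst integral_density)
         (auto intro!: borel_measurable_integrable integrable_square continuous_intros)
    also have "\<dots> = (\<integral>z. h z * f z ^ i \<partial>square) / c"
      by (simp add: divide_inverse mult_ac flip: integral_mult_right_zero)
    finally have "c * moment (distr D (restrict_space borel {0..1}) f) i = (\<integral>z. h z * f z ^ i \<partial>square)"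
      using c by simp
    moreover have "distr D (restrict_space borel {0..1}) f \<in> mixed_actions"
      using prob_space.prob_space_distr[OF D fm] by (simp add: mixed_actions_def)
    ultimately show ?thesis by blast
  qed
  show ?thesis
    by (rule that[of "distr D (restrict_space borel {0..1}) fst" "distr D (restrict_space borel {0..1}) snd"])
       (use marginal[of fst] marginal[of snd] in \<open>auto simp: c_def continuous_on_fst continuous_on_snd continuous_on_id\<close>)
qed

text \<open>
  A second-order bound with explicit remainder. It replaces differentiation under the integral.
\<close>
lemma square_pos_part_add_le: "(max 0 (a + h))\<^sup>2 \<le> (max 0 a)\<^sup>2 + 2 * (max 0 a * h) + h\<^sup>2" for a h :: real
proof -
  have "\<bar>max 0 (a + h)\<bar> \<le> \<bar>max 0 a + h\<bar>" by (simp add: max_def)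
  then have "(max 0 (a + h))\<^sup>2 \<le> (max 0 a + h)\<^sup>2" by (simp only: abs_le_square_iff)
  then show ?thesis by (simp add: power2_sum)
qed

text \<open>
  By bilinearity a weighted integral can be moved into either slot of the form. This is how the
  antisymmetry of the regret is exploited without exchanging integrals.
\<close>
lemma integral_moment_form_mult:
  assumes "\<And>i. integrable M (\<lambda>z. h z * u z i)"
  shows "(\<integral>z. h z * moment_form q (u z) w \<partial>M) = moment_form q (\<lambda>i. \<integral>z. h z * u z i \<partial>M) w"
    and "(\<integral>z. h z * moment_form q w (u z) \<partial>M) = moment_form q w (\<lambda>i. \<integral>z. h z * u z i \<partial>M)"
proof -
  have 1: "h z * moment_form q (u z) w = (\<Sum>i\<le>degree q. \<Sum>j\<le>degree (coeff q i).
      (coeff (coeff q i) j * w j) * (h z * u z i))"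
    "h z * moment_form q w (u z) = (\<Sum>i\<le>degree q. \<Sum>j\<le>degree (coeff q i).
      (coeff (coeff q i) j * w i) * (h z * u z j))" for z
    by (simp_all add: moment_form_def sum_distrib_left mult_ac)
  show "(\<integral>z. h z * moment_form q (u z) w \<partial>M) = moment_form q (\<lambda>i. \<integral>z. h z * u z i \<partial>M) w"
    unfolding 1 by (simp add: assms) (simp add: moment_form_def mult_ac)
  show "(\<integral>z. h z * moment_form q w (u z) \<partial>M) = moment_form q w (\<lambda>i. \<integral>z. h z * u z i \<partial>M)"
    unfolding 1 by (simp add: assms) (simp add: moment_form_def mult_ac)
qed

lemma moment_form_scale:
  "moment_form q (\<lambda>i. c * u i) w = c * moment_form q u w"
  "moment_form q u (\<lambda>i. c * w i) = c * moment_form q u w"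
  by (simp_all add: moment_form_def sum_distrib_left mult_ac)

text \<open>
  With \<open>h = g\<^sup>+\<close> and \<open>(m',n')\<close> the normalized marginals of \<open>h\<close>, moving a fraction \<open>t\<close> towards
  \<open>(m',n')\<close> changes the total regret \<open>R\<close> by at most \<open>-2tR + t\<^sup>2C\<close>. The linear coefficient comes from
  \<open>\<integral>hg = R\<close> and from the fact that \<open>h\<close> is orthogonal to the regret of \<open>(m',n')\<close>. At a minimizer
  this change is nonnegative for all small \<open>t\<close>, which forces \<open>R = 0\<close> and thus \<open>h = 0\<close>.
\<close>
lemma regret_of_minimizer_nonpos:
  assumes m: "m \<in> mixed_actions" and n: "n \<in> mixed_actions"
    and min: "\<And>m' n'. m' \<in> mixed_actions \<Longrightarrow> n' \<in> mixed_actions \<Longrightarrow> total_regret q m n \<le> total_regret q m' n'"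
    and z: "z \<in> {0..1} \<times> {0..1}"
  shows "regret q m n z \<le> 0"
proof (rule ccontr)
  assume nz: "\<not> regret q m n z \<le> 0"
  define h where "h z = max 0 (regret q m n z)" for z
  have total: "total_regret q m n = (\<integral>z. (h z)\<^sup>2 \<partial>square)"
    by (simp add: total_regret_def h_def)
  have hc: "continuous_on UNIV h"
    unfolding h_def by (rule continuous_on_max[OF continuous_on_const continuous_on_regret])
  have h2c: "continuous_on UNIV (\<lambda>z. (h z)\<^sup>2)"
    by (rule continuous_on_power[OF hc])
  have h0: "0 \<le> h z" for z by (simp add: h_def)
  have hz: "h z > 0" using nz by (simp add: h_def)
  have pos: "0 < (\<integral>z. h z \<partial>square)"
  proof -
    have "(\<integral>z. h z \<partial>square) \<noteq> 0"
      using square_integral_zero_imp_zero[OF hc h0 _ z] hz by auto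
    moreover have "0 \<le> (\<integral>z. h z \<partial>square)" using h0 by simp
    ultimately show ?thesis by simp
  qed
  have tpos: "0 < total_regret q m n"
  proof -
    have "total_regret q m n \<noteq> 0"
      using square_integral_zero_imp_zero[OF h2c zero_le_power2 _ z] hz unfolding total by auto
    moreover have "0 \<le> total_regret q m n" by (simp add: total_regret_def)
    ultimately show ?thesis by simp
  qed
  define c where "c = (\<integral>z. h z \<partial>square)"
  obtain m' n' where m': "m' \<in> mixed_actions" and n': "n' \<in> mixed_actions"
    and mm: "\<And>i. c * moment m' i = (\<integral>z. h z * fst z ^ i \<partial>square)"
    and nn: "\<And>i. c * moment n' i = (\<integral>z. h z * snd z ^ i \<partial>square)"
    by (rule density_marginals[OF hc h0 pos, folded c_def]) (rule that)
  have regret_int: "integrable square (\<lambda>z. h z * regret q a b z)" for a b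
    by (rule integrable_square[OF continuous_on_mult[OF hc continuous_on_regret]])
  have form_int:
    "integrable square (\<lambda>z. h z * moment_form q (power (fst z)) w)"
    "integrable square (\<lambda>z. h z * moment_form q w (power (snd z)))"
    "integrable square (\<lambda>z. h z * fst z ^ i)" "integrable square (\<lambda>z. h z * snd z ^ i)" for w i
    by (rule integrable_square[OF continuous_on_mult[OF hc]],
        intro continuous_on_moment_form continuous_intros)+
  \<comment> \<open>Both half-mixed payoffs of \<open>(m',n')\<close>, weighted by \<open>h\<close>, equal the same bilinear expression.\<close>
  have skew: "(\<integral>z. h z * regret q m' n' z \<partial>square) = 0"
  proof -
    have "(\<integral>z. h z * moment_form q (power (fst z)) (moment n') \<partial>square)
        = c * moment_form q (moment m') (moment n')"
      by (simp add: integral_moment_form_mult form_int mm[symmetric] moment_form_scale)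
    moreover have "(\<integral>z. h z * moment_form q (moment m') (power (snd z)) \<partial>square)
        = c * moment_form q (moment m') (moment n')"
      by (simp add: integral_moment_form_mult form_int nn[symmetric] moment_form_scale)
    ultimately show ?thesis
      by (simp add: regret_def right_diff_distrib form_int)
  qed
  have self: "(\<integral>z. h z * regret q m n z \<partial>square) = total_regret q m n"
    unfolding total
    by (rule Bochner_Integration.integral_cong) (auto simp: h_def max_def power2_eq_square)
  define d where "d z = regret q m' n' z - regret q m n z" for z
  define C where "C = (\<integral>z. (d z)\<^sup>2 \<partial>square)"
  have dc: "continuous_on UNIV d"
    unfolding d_def by (rule continuous_on_diff[OF continuous_on_regret continuous_on_regret])
  have ints: "integrable square (\<lambda>z. (h z)\<^sup>2)" "integrable square (\<lambda>z. h z * d z)"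
    "integrable square (\<lambda>z. (d z)\<^sup>2)"
    by (rule integrable_square, intro continuous_on_mult continuous_on_power hc dc)+
  have hd: "(\<integral>z. h z * d z \<partial>square) = - total_regret q m n"
    by (simp add: d_def right_diff_distrib regret_int skew self)
  have key: "2 * total_regret q m n \<le> t * C" if t: "0 < t" "t \<le> 1" for t
  proof -
    obtain mt where mt: "mt \<in> mixed_actions"
      "\<And>i. moment mt i = (1 - t) * moment m i + t * moment m' i"
      using mixture_moments[OF m m', of t] t by auto
    obtain nt where nt: "nt \<in> mixed_actions"
      "\<And>i. moment nt i = (1 - t) * moment n i + t * moment n' i"
      using mixture_moments[OF n n', of t] t by auto
    have mt2: "moment mt = (\<lambda>i. (1 - t) * moment m i + t * moment m' i)"
      and nt2: "moment nt = (\<lambda>i. (1 - t) * moment n i + t * moment n' i)"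
      using mt nt by auto
    have r: "regret q mt nt z = regret q m n z + t * d z" for z
      unfolding regret_def d_def mt2 nt2 moment_form_convex_left moment_form_convex_right
      by (simp add: algebra_simps)
    have le: "(max 0 (regret q mt nt z))\<^sup>2 \<le> (h z)\<^sup>2 + (2 * t) * (h z * d z) + t\<^sup>2 * (d z)\<^sup>2" for z
      using square_pos_part_add_le[of "regret q m n z" "t * d z"]
      by (simp add: r h_def power_mult_distrib mult_ac)
    have "total_regret q m n \<le> total_regret q mt nt" using min mt nt by blast
    also have "\<dots> \<le> (\<integral>z. (h z)\<^sup>2 + (2 * t) * (h z * d z) + t\<^sup>2 * (d z)\<^sup>2 \<partial>square)"
      unfolding total_regret_def
    proof (rule integral_mono[OF _ _ le])
      show "integrable square (\<lambda>z. (max 0 (regret q mt nt z))\<^sup>2)"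
        by (intro integrable_square continuous_on_power continuous_on_max continuous_on_const
            continuous_on_regret)
    qed (simp add: ints)
    also have "\<dots> = total_regret q m n - 2 * t * total_regret q m n + t\<^sup>2 * C"
      by (simp add: ints hd C_def total)
    finally have "t * (2 * total_regret q m n) \<le> t * (t * C)"
      by (simp add: power2_eq_square)
    then show ?thesis using t by simp
  qed
  have "2 * total_regret q m n \<le> 1 * C" by (rule key) auto
  then have "0 < C" using tpos by simp
  \<comment> \<open>For this \<open>t\<close> the quadratic remainder is too small to compensate the linear decrease.\<close>
  define t where "t = min 1 (total_regret q m n / C)"
  have "2 * total_regret q m n \<le> t * C"
    by (rule key) (use tpos \<open>0 < C\<close> in \<open>auto simp: t_def\<close>)
  also have "t * C \<le> total_regret q m n / C * C"
    using \<open>0 < C\<close> by (intro mult_right_mono) (auto simp: t_def)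
  finally show False using tpos \<open>0 < C\<close> by simp
qed

theorem saddle_point_exists: "\<exists>m n. saddle_point q m n"
proof -
  obtain m n where mn: "m \<in> mixed_actions" "n \<in> mixed_actions"
    "\<And>m' n'. m' \<in> mixed_actions \<Longrightarrow> n' \<in> mixed_actions \<Longrightarrow> total_regret q m n \<le> total_regret q m' n'"
    using total_regret_has_minimum by blast
  have "saddle_point q m n"
  proof (rule saddle_pointI)
    fix x y :: real assume "x \<in> {0..1}" "y \<in> {0..1}"
    then show "moment_form q (power x) (moment n) \<le> moment_form q (moment m) (power y)"
      using regret_of_minimizer_nonpos[OF mn, of "(x, y)"] by (simp add: regret_def)
  qed fact+
  then show ?thesis by blast
qed

section \<open>The value of a polynomial game\<close>

lemma eval2_add: "eval2 (q + q') x y = eval2 q x y + eval2 q' x y"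
  and eval2_smult: "eval2 (smult [:c:] q) x y = c * eval2 q x y"
  and eval2_sum: "eval2 (\<Sum>t\<in>A. Q t) x y = (\<Sum>t\<in>A. eval2 (Q t) x y)"
  by (simp_all add: eval2_def poly_sum)

lemma integrable_eval2:
  assumes "m \<in> mixed_actions"
  shows "integrable m (\<lambda>x. eval2 q x y)"
  unfolding eval2_eq_moment_form
  by (intro integrable_mixed_action[OF assms] continuous_on_moment_form continuous_intros)

lemma integrable_integral_eval2:
  assumes "m \<in> mixed_actions" "n \<in> mixed_actions"
  shows "integrable n (\<lambda>y. \<integral>x. eval2 q x y \<partial>m)"
  unfolding eval2_eq_moment_form integral_moment_form_left[OF assms(1)]
  by (intro integrable_mixed_action[OF assms(2)] continuous_on_moment_form continuous_intros)

lemma mixed_ext_auxiliary_game: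
  assumes "m \<in> mixed_actions" "n \<in> mixed_actions"
  shows "mixed_ext (auxiliary_game \<beta> r p \<alpha> s) m n
    = mixed_ext (r s) m n + \<beta> * (\<Sum>t\<in>UNIV. mixed_ext (p t s) m n * \<alpha> $ t)"
  using assms
  by (simp add: mixed_ext_def auxiliary_game_def eval2_add eval2_smult eval2_sum
      integrable_eval2 integrable_integral_eval2 mult.commute)

lemma mixed_ext_le_add:
  assumes m: "m \<in> mixed_actions" and n: "n \<in> mixed_actions"
    and le: "\<And>x y. x \<in> {0..1} \<Longrightarrow> y \<in> {0..1} \<Longrightarrow> eval2 q x y \<le> eval2 q' x y + e"
  shows "mixed_ext q m n \<le> mixed_ext q' m n + e"
proof -
  interpret m: prob_space m using m by (rule mixed_actions_prob_space)
  interpret n: prob_space n using n by (rule mixed_actions_prob_space)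
  have "mixed_ext q m n \<le> (\<integral>y. (\<integral>x. eval2 q' x y + e \<partial>m) \<partial>n)"
    unfolding mixed_ext_def
  proof (rule integral_mono)
    fix y assume "y \<in> space n"
    then have "y \<in> {0..1}" by (simp add: mixed_actions_space[OF n])
    then show "(\<integral>x. eval2 q x y \<partial>m) \<le> (\<integral>x. eval2 q' x y + e \<partial>m)"
      by (intro integral_mono)
         (auto simp: integrable_eval2[OF m] mixed_actions_space[OF m] intro!: le)
  qed (simp_all add: integrable_eval2[OF m] integrable_integral_eval2[OF m n] m.prob_space)
  also have "\<dots> = mixed_ext q' m n + e"
    by (simp add: mixed_ext_def integrable_eval2[OF m] integrable_integral_eval2[OF m n]
        m.prob_space n.prob_space)
  finally show ?thesis .
qed

lemma saddle_pointD:
  assumes "saddle_point q m n"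
  shows "m \<in> mixed_actions" "n \<in> mixed_actions"
    "\<And>m'. m' \<in> mixed_actions \<Longrightarrow> mixed_ext q m' n \<le> mixed_ext q m n"
    "\<And>n'. n' \<in> mixed_actions \<Longrightarrow> mixed_ext q m n \<le> mixed_ext q m n'"
  using assms by (auto simp: saddle_point_def)

text \<open>
  Going round the four payoffs \<open>(m,n) \<le> (m,n') \<le> (m',n') \<le> (m',n) \<le> (m,n)\<close> closes a cycle, so all of
  them are equal.
\<close>
lemma saddle_point_interchange:
  assumes 1: "saddle_point q m n" and 2: "saddle_point q m' n'"
  shows "saddle_point q m n'" "mixed_ext q m n = mixed_ext q m' n'" 
proof -
  note m = saddle_pointD[OF 1] and m' = saddle_pointD[OF 2]
  have "mixed_ext q m n \<le> mixed_ext q m n'" "mixed_ext q m n' \<le> mixed_ext q m' n'"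
    "mixed_ext q m' n' \<le> mixed_ext q m' n" "mixed_ext q m' n \<le> mixed_ext q m n"
    using m m' by blast+
  then have eq: "mixed_ext q m n = mixed_ext q m' n'" "mixed_ext q m n' = mixed_ext q m' n'"
    by linarith+
  then show "mixed_ext q m n = mixed_ext q m' n'" by simp
  show "saddle_point q m n'"
    using m m' eq by (simp add: saddle_point_def)
qed

lemma val_eq:
  assumes "saddle_point q m n"
  shows "val q = mixed_ext q m n"
  unfolding val_def
proof (rule the_equality)
  show "\<exists>m' n'. saddle_point q m' n' \<and> mixed_ext q m n = mixed_ext q m' n'"
    using assms by blast
  show "v = mixed_ext q m n" if "\<exists>m' n'. saddle_point q m' n' \<and> v = mixed_ext q m' n'" for v
    using that saddle_point_interchange(2)[OF assms] by auto
qed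

lemma saddle_point_of_optimal:
  assumes "optimal1 q m" "optimal2 q n"
  shows "saddle_point q m n"
  using assms saddle_point_interchange(1) unfolding optimal1_def optimal2_def by blast

text \<open>
  Play an optimal action of player 1 for \<open>q\<close> against an optimal action of player 2 for \<open>q'\<close>.
\<close>
lemma val_le_add:
  assumes le: "\<And>x y. x \<in> {0..1} \<Longrightarrow> y \<in> {0..1} \<Longrightarrow> eval2 q x y \<le> eval2 q' x y + e"
  shows "val q \<le> val q' + e"
proof -
  obtain m n where 1: "saddle_point q m n" using saddle_point_exists by blast
  obtain m' n' where 2: "saddle_point q' m' n'" using saddle_point_exists by blast
  note m = saddle_pointD[OF 1] and m' = saddle_pointD[OF 2]
  have "mixed_ext q m n \<le> mixed_ext q m n'" using m m' by blast
  also have "\<dots> \<le> mixed_ext q' m n' + e" using m(1) m'(2) le by (rule mixed_ext_le_add)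
  also have "\<dots> \<le> mixed_ext q' m' n' + e" using m m' by simp
  finally show ?thesis by (simp add: val_eq[OF 1] val_eq[OF 2])
qed

section \<open>The Shapley operator is a contraction\<close>
lemma eval2_auxiliary_game:
  "eval2 (auxiliary_game \<beta> r p \<alpha> s) x y
     = eval2 (r s) x y + \<beta> * (\<Sum>t\<in>UNIV. \<alpha> $ t * eval2 (p t s) x y)"
  by (simp add: auxiliary_game_def eval2_add eval2_smult eval2_sum)

text \<open>
  At every pair of pure actions the two payoffs differ by \<open>\<beta>\<close> times a convex combination of the
  differences \<open>\<alpha>\<^sub>t - \<alpha>'\<^sub>t\<close>.
\<close>
lemma shapley_contraction:
  assumes p: "transition_polys p" and \<beta>: "0 \<le> \<beta>"
    and d: "\<And>t. \<bar>\<alpha> $ t - \<alpha>' $ t\<bar> \<le> d"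
  shows "\<bar>shapley \<beta> r p \<alpha> $ s - shapley \<beta> r p \<alpha>' $ s\<bar> \<le> \<beta> * d"
proof -
  have le: "eval2 (auxiliary_game \<beta> r p a s) x y \<le> eval2 (auxiliary_game \<beta> r p a' s) x y + \<beta> * d"
    if xy: "x \<in> {0..1}" "y \<in> {0..1}" and aa: "\<And>t. a $ t \<le> a' $ t + d" for x y a a'
  proof -
    have P: "\<And>t. 0 \<le> eval2 (p t s) x y" "(\<Sum>t\<in>UNIV. eval2 (p t s) x y) = 1"
      using p xy by (auto simp: transition_polys_def)
    have "(\<Sum>t\<in>UNIV. a $ t * eval2 (p t s) x y) \<le> (\<Sum>t\<in>UNIV. (a' $ t + d) * eval2 (p t s) x y)"
      by (intro sum_mono mult_right_mono aa P)
    also have "\<dots> = (\<Sum>t\<in>UNIV. a' $ t * eval2 (p t s) x y) + d"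
      by (simp add: distrib_right sum.distrib P flip: sum_distrib_left)
    finally have "\<beta> * (\<Sum>t\<in>UNIV. a $ t * eval2 (p t s) x y)
        \<le> \<beta> * ((\<Sum>t\<in>UNIV. a' $ t * eval2 (p t s) x y) + d)"
      using \<beta> by (rule mult_left_mono)
    then show ?thesis by (simp add: eval2_auxiliary_game distrib_left)
  qed
  have "\<alpha> $ t \<le> \<alpha>' $ t + d" "\<alpha>' $ t \<le> \<alpha> $ t + d" for t
    using d[of t] by auto
  then have "val (auxiliary_game \<beta> r p \<alpha> s) \<le> val (auxiliary_game \<beta> r p \<alpha>' s) + \<beta> * d"
    "val (auxiliary_game \<beta> r p \<alpha>' s) \<le> val (auxiliary_game \<beta> r p \<alpha> s) + \<beta> * d"
    by (auto intro!: val_le_add le)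
  then show ?thesis by (auto simp: shapley_def)
qed

text \<open>
  The metric on \<^typ>\<open>real ^ 's\<close> is Euclidean, for which \<open>f\<close> itself need not contract. Norm equivalence
  costs a factor \<^term>\<open>CARD('s)\<close>, which a high iterate \<open>f\<^sup>k\<close> absorbs. The unique fixed point
  of \<open>f\<^sup>k\<close> is mapped by \<open>f\<close> to a fixed point of \<open>f\<^sup>k\<close>, that is, to itself.
\<close>
lemma unique_fixed_point_of_sup_contraction:
  fixes f :: "real ^ 's::finite \<Rightarrow> real ^ 's"
  assumes b: "0 \<le> b" "b < 1"
    and f: "\<And>x y d s. (\<And>t. \<bar>x $ t - y $ t\<bar> \<le> d) \<Longrightarrow> \<bar>f x $ s - f y $ s\<bar> \<le> b * d"
  shows "\<exists>!x. f x = x"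
proof -
  have iter: "\<bar>(f ^^ k) x $ s - (f ^^ k) y $ s\<bar> \<le> b ^ k * norm (x - y)" for k x y s
  proof (induction k arbitrary: s)
    case 0
    show ?case using component_le_norm_cart[of "x - y" s] by simp
  next
    case (Suc k)
    have "\<bar>f ((f ^^ k) x) $ s - f ((f ^^ k) y) $ s\<bar> \<le> b * (b ^ k * norm (x - y))"
      by (rule f) (rule Suc)
    then show ?case by (simp add: mult.assoc)
  qed
  have "(\<lambda>k. real CARD('s) * b ^ k) \<longlonglongrightarrow> 0"
    using b by (intro tendsto_mult_right_zero LIMSEQ_realpow_zero)
  then have "\<forall>\<^sub>F k in sequentially. real CARD('s) * b ^ k < 1"
    by (rule order_tendstoD) simp
  then obtain k where k: "real CARD('s) * b ^ k < 1"
    by (auto simp: eventually_sequentially)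
  have "dist ((f ^^ k) x) ((f ^^ k) y) \<le> (real CARD('s) * b ^ k) * dist x y" for x y
  proof -
    have "norm ((f ^^ k) x - (f ^^ k) y) \<le> (\<Sum>s\<in>UNIV. \<bar>((f ^^ k) x - (f ^^ k) y) $ s\<bar>)"
      by (rule norm_le_l1_cart)
    also have "\<dots> \<le> (\<Sum>s::'s\<in>UNIV. b ^ k * norm (x - y))"
      by (intro sum_mono) (simp add: iter)
    finally show ?thesis by (simp add: dist_norm)
  qed
  then have "\<exists>!x. (f ^^ k) x = x"
    using b k by (intro banach_fix_type[where c = "real CARD('s) * b ^ k"]) auto
  then obtain x where x: "(f ^^ k) x = x" and uniq: "\<And>y. (f ^^ k) y = y \<Longrightarrow> y = x"
    by blast
  have "(f ^^ k) (f x) = f ((f ^^ k) x)" by (rule funpow_swap1[symmetric])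
  then have "f x = x" by (intro uniq) (simp only: x)
  moreover have "y = x" if "f y = y" for y
  proof -
    have "(f ^^ k) y = y" by (induction k) (simp_all add: that)
    then show ?thesis by (rule uniq)
  qed
  ultimately show ?thesis by blast
qed

section \<open>Discounted linear equations with a stochastic matrix\<close>
definition stochastic :: "real ^ 's ^ 's::finite \<Rightarrow> bool" where
  "stochastic P \<longleftrightarrow> (\<forall>s. (\<forall>t. 0 \<le> P $ s $ t) \<and> (\<Sum>t\<in>UNIV. P $ s $ t) = 1)"

text \<open>
  Maximum principle: at a maximal entry \<open>s\<^sub>0\<close> the row average is at most \<open>d\<^sub>s\<^sub>0\<close>, so
  \<open>d\<^sub>s\<^sub>0 \<le> b d\<^sub>s\<^sub>0\<close>.
\<close>
lemma stochastic_discounted_nonpos: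
  assumes P: "stochastic P" and b: "0 \<le> b" "b < 1"
    and d: "\<And>s. d $ s \<le> b * (P *v d) $ s"
  shows "d $ s \<le> 0"
proof -
  have "Max (range (($) d)) \<in> range (($) d)" by (rule Max_in) auto
  then obtain s0 where "Max (range (($) d)) = d $ s0" by blast
  then have s0: "d $ t \<le> d $ s0" for t
    using Max_ge[of "range (($) d)" "d $ t"] by simp
  have "(P *v d) $ s0 \<le> (\<Sum>t\<in>UNIV. P $ s0 $ t * d $ s0)"
    unfolding matrix_vector_mult_def using P s0
    by (auto intro!: sum_mono mult_left_mono simp: stochastic_def)
  also have "\<dots> = d $ s0"
    using P by (simp add: stochastic_def flip: sum_distrib_right)
  finally have "b * (P *v d) $ s0 \<le> b * d $ s0"
    using b(1) by (rule mult_left_mono)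
  with d[of s0] have "d $ s0 \<le> b * d $ s0" by simp
  then have "(1 - b) * d $ s0 \<le> 0" by (simp add: algebra_simps)
  then have "d $ s0 \<le> 0" using b by (simp add: mult_le_0_iff)
  with s0[of s] show ?thesis by simp
qed

text \<open>
  The maximum principle applied to \<open>x\<close> and \<open>-x\<close> shows that the kernel is trivial.
\<close>
lemma invertible_discounted:
  fixes P :: "real ^ 's ^ 's::finite"
  assumes P: "stochastic P" and b: "0 \<le> b" "b < 1"
  shows "invertible (mat 1 - b *\<^sub>R P)"
proof -
  have "x = 0" if "(mat 1 - b *\<^sub>R P) *v x = 0" for x
  proof -
    have eq: "x = b *\<^sub>R (P *v x)"
      using that by (simp add: matrix_vector_mult_diff_rdistrib scaleR_matrix_vector_assoc)
    have eqs: "x $ s = b * (P *v x) $ s" for s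
      by (subst eq) simp
    have neg: "P *v (- x) = - (P *v x)"
      by (simp add: matrix_vector_mult_def vec_eq_iff sum_negf)
    have "x $ s \<le> 0" "(- x) $ s \<le> 0" for s
      by (rule stochastic_discounted_nonpos[OF P b], simp add: eqs[symmetric] neg)+
    then show ?thesis by (simp add: vec_eq_iff order_antisym)
  qed
  then show ?thesis
    by (simp add: invertible_left_inverse matrix_left_invertible_ker)
qed

lemma discounted_solution_iff:
  fixes P :: "real ^ 's ^ 's::finite"
  assumes P: "stochastic P" and b: "0 \<le> b" "b < 1"
  shows "v = matrix_inv (mat 1 - b *\<^sub>R P) *v c \<longleftrightarrow> v = c + b *\<^sub>R (P *v v)"
proof -
  define A where "A = mat 1 - b *\<^sub>R P"
  have "A ** matrix_inv A = mat 1 \<and> matrix_inv A ** A = mat 1"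
    using invertible_discounted[OF assms]
    unfolding A_def[symmetric] invertible_def matrix_inv_def by (rule someI_ex)
  then have inv: "A *v (matrix_inv A *v x) = x" "matrix_inv A *v (A *v x) = x" for x
    by (simp_all add: matrix_vector_mul_assoc)
  have "v = matrix_inv A *v c \<longleftrightarrow> A *v v = c"
    using inv by auto
  also have "\<dots> \<longleftrightarrow> v = c + b *\<^sub>R (P *v v)"
    by (auto simp: A_def matrix_vector_mult_diff_rdistrib scaleR_matrix_vector_assoc algebra_simps)
  finally show ?thesis by (simp add: A_def)
qed

section \<open>Equilibria and fixed points of the Shapley operator\<close>
lemma stochastic_transition_matrix:
  assumes p: "transition_polys p" and \<mu>: "mixed_strategy \<mu>" and \<nu>: "mixed_strategy \<nu>"
  shows "stochastic (transition_matrix p \<mu> \<nu>)"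
  unfolding stochastic_def
proof (intro allI conjI)
  fix s
  have m: "\<mu> s \<in> mixed_actions" and n: "\<nu> s \<in> mixed_actions"
    using \<mu> \<nu> by (auto simp: mixed_strategy_def)
  interpret m: prob_space "\<mu> s" using m by (rule mixed_actions_prob_space)
  interpret n: prob_space "\<nu> s" using n by (rule mixed_actions_prob_space)
  have P: "\<And>x y t. x \<in> {0..1} \<Longrightarrow> y \<in> {0..1} \<Longrightarrow> 0 \<le> eval2 (p t s) x y"
    "\<And>x y. x \<in> {0..1} \<Longrightarrow> y \<in> {0..1} \<Longrightarrow> (\<Sum>t\<in>UNIV. eval2 (p t s) x y) = 1"
    using p by (auto simp: transition_polys_def)
  show "0 \<le> transition_matrix p \<mu> \<nu> $ s $ t" for t
    using mixed_ext_le_add[OF m n, of 0 "p t s" 0] P(1)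
    by (simp add: transition_matrix_def mixed_ext_def eval2_def)
  have "(\<Sum>t\<in>UNIV. transition_matrix p \<mu> \<nu> $ s $ t) = (\<integral>y. (\<integral>x. (\<Sum>t\<in>UNIV. eval2 (p t s) x y) \<partial>\<mu> s) \<partial>\<nu> s)"
    by (simp add: transition_matrix_def mixed_ext_def integrable_eval2[OF m]
        integrable_integral_eval2[OF m n])
  also have "\<dots> = (\<integral>y. (\<integral>x. 1 \<partial>\<mu> s) \<partial>\<nu> s)"
    by (intro Bochner_Integration.integral_cong)
       (auto simp: mixed_actions_space[OF m] mixed_actions_space[OF n] P(2))
  finally show "(\<Sum>t\<in>UNIV. transition_matrix p \<mu> \<nu> $ s $ t) = 1"
    by (simp add: m.prob_space n.prob_space)
qed

text \<open>
  Playing one round and then receiving \<open>\<alpha>\<close> is the same as playing the auxiliary game. This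
  identity translates between the linear algebra of \<open>r + \<beta>P\<alpha>\<close> and the static games.
\<close>
lemma one_step_payoff:
  assumes "mixed_strategy \<mu>" "mixed_strategy \<nu>"
  shows "(reward_vector r \<mu> \<nu> + \<beta> *\<^sub>R (transition_matrix p \<mu> \<nu> *v \<alpha>)) $ s
    = mixed_ext (auxiliary_game \<beta> r p \<alpha> s) (\<mu> s) (\<nu> s)"
  using assms
  by (simp add: mixed_strategy_def mixed_ext_auxiliary_game reward_vector_def
      transition_matrix_def matrix_vector_mult_def)

context
  fixes r :: "'s::finite \<Rightarrow> real poly poly"
    and p :: "'s \<Rightarrow> 's \<Rightarrow> real poly poly"
    and \<beta> :: real
  assumes p: "transition_polys p" and \<beta>: "0 \<le> \<beta>" "\<beta> < 1"
begin

lemma discounted_reward_iff: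
  assumes "mixed_strategy \<mu>" "mixed_strategy \<nu>"
  shows "v = discounted_reward \<beta> r p \<mu> \<nu>
    \<longleftrightarrow> (\<forall>s. v $ s = mixed_ext (auxiliary_game \<beta> r p v s) (\<mu> s) (\<nu> s))"
  unfolding discounted_reward_def
    discounted_solution_iff[OF stochastic_transition_matrix[OF p assms] \<beta>]
  by (simp only: vec_eq_iff one_step_payoff[OF assms])

lemma discounted_reward_eq:
  assumes "mixed_strategy \<mu>" "mixed_strategy \<nu>"
  shows "discounted_reward \<beta> r p \<mu> \<nu> $ s
    = mixed_ext (auxiliary_game \<beta> r p (discounted_reward \<beta> r p \<mu> \<nu>) s) (\<mu> s) (\<nu> s)"
  using discounted_reward_iff[OF assms] by blast

lemma auxiliary_payoff_diff:
  assumes "mixed_strategy \<mu>" "mixed_strategy \<nu>"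
  shows "mixed_ext (auxiliary_game \<beta> r p u s) (\<mu> s) (\<nu> s)
       - mixed_ext (auxiliary_game \<beta> r p v s) (\<mu> s) (\<nu> s)
     = \<beta> * (transition_matrix p \<mu> \<nu> *v (u - v)) $ s"
  unfolding one_step_payoff[OF assms, symmetric]
  by (simp add: matrix_vector_mult_diff_distrib right_diff_distrib)

text \<open>
  By the maximum principle for \<open>u - w\<close>, where \<open>w\<close> is the discounted reward: the constant term \<open>r\<close>
  cancels in \<open>u - w \<le> \<beta>P(u - w)\<close>.
\<close>
lemma le_discounted_reward:
  assumes \<mu>\<nu>: "mixed_strategy \<mu>" "mixed_strategy \<nu>"
    and u: "\<And>s. u $ s \<le> mixed_ext (auxiliary_game \<beta> r p u s) (\<mu> s) (\<nu> s)"
  shows "u \<le> discounted_reward \<beta> r p \<mu> \<nu>"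
proof -
  define w where "w = discounted_reward \<beta> r p \<mu> \<nu>"
  have "(u - w) $ s \<le> \<beta> * (transition_matrix p \<mu> \<nu> *v (u - w)) $ s" for s
    using u[of s] auxiliary_payoff_diff[OF \<mu>\<nu>, of u s w]
      discounted_reward_eq[OF \<mu>\<nu>, of s] by (simp add: w_def)
  then have "(u - w) $ s \<le> 0" for s
    by (rule stochastic_discounted_nonpos[OF stochastic_transition_matrix[OF p \<mu>\<nu>] \<beta>])
  then show ?thesis by (simp add: less_eq_vec_def w_def)
qed

lemma discounted_reward_le:
  assumes \<mu>\<nu>: "mixed_strategy \<mu>" "mixed_strategy \<nu>"
    and u: "\<And>s. mixed_ext (auxiliary_game \<beta> r p u s) (\<mu> s) (\<nu> s) \<le> u $ s"
  shows "discounted_reward \<beta> r p \<mu> \<nu> \<le> u"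
proof -
  define w where "w = discounted_reward \<beta> r p \<mu> \<nu>"
  have "(w - u) $ s \<le> \<beta> * (transition_matrix p \<mu> \<nu> *v (w - u)) $ s" for s
    using u[of s] auxiliary_payoff_diff[OF \<mu>\<nu>, of w s u]
      discounted_reward_eq[OF \<mu>\<nu>, of s] by (simp add: w_def)
  then have "(w - u) $ s \<le> 0" for s
    by (rule stochastic_discounted_nonpos[OF stochastic_transition_matrix[OF p \<mu>\<nu>] \<beta>])
  then show ?thesis by (simp add: less_eq_vec_def w_def)
qed

text \<open>
  If player 1 deviates from a saddle point, the payoffs of all auxiliary games at \<open>\<phi>\<close> are at most
  \<open>\<phi>\<close>, so by comparison the whole discounted reward is at most \<open>\<phi>\<close>; dually for player 2.
\<close>
lemma equilibrium_of_saddle_points: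
  assumes fixpt: "shapley \<beta> r p \<phi> = \<phi>"
    and sp: "\<And>s. saddle_point (auxiliary_game \<beta> r p \<phi> s) (\<mu> s) (\<nu> s)"
  shows "equilibrium \<beta> r p \<mu> \<nu>" "discounted_reward \<beta> r p \<mu> \<nu> = \<phi>"
proof -
  have \<mu>: "mixed_strategy \<mu>" and \<nu>: "mixed_strategy \<nu>"
    using saddle_pointD[OF sp] by (auto simp: mixed_strategy_def)
  have \<phi>: "mixed_ext (auxiliary_game \<beta> r p \<phi> s) (\<mu> s) (\<nu> s) = \<phi> $ s" for s
    using arg_cong[OF fixpt, of "\<lambda>v. v $ s"] val_eq[OF sp, of s] by (simp add: shapley_def)
  show eq: "discounted_reward \<beta> r p \<mu> \<nu> = \<phi>"
    using discounted_reward_iff[OF \<mu> \<nu>, of \<phi>] \<phi> by simp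
  show "equilibrium \<beta> r p \<mu> \<nu>"
    unfolding equilibrium_def eq
  proof (intro conjI allI impI \<mu> \<nu>)
    fix \<mu>' :: "'s \<Rightarrow> real measure" assume \<mu>': "mixed_strategy \<mu>'"
    show "discounted_reward \<beta> r p \<mu>' \<nu> \<le> \<phi>"
      by (rule discounted_reward_le[OF \<mu>' \<nu>])
         (use \<mu>' saddle_pointD(3)[OF sp] in \<open>simp add: \<phi>[symmetric] mixed_strategy_def\<close>)
  next
    fix \<nu>' :: "'s \<Rightarrow> real measure" assume \<nu>': "mixed_strategy \<nu>'"
    show "\<phi> \<le> discounted_reward \<beta> r p \<mu> \<nu>'"
      by (rule le_discounted_reward[OF \<mu> \<nu>'])
         (use \<nu>' saddle_pointD(4)[OF sp] in \<open>simp add: \<phi>[symmetric] mixed_strategy_def\<close>)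
  qed
qed

text \<open>
  One-shot deviations suffice. A profitable action \<open>m\<close> at one state, with \<open>\<mu>\<close> kept elsewhere, gives by
  comparison a reward \<open>w \<ge> v\<close>, while equilibrium gives \<open>w \<le> v\<close>. Then \<open>w = v\<close>, and the equation for \<open>w\<close>
  at that state says that \<open>m\<close> was not profitable.
\<close>
lemma value_vector_is_fixed_point:
  assumes "value_vector \<beta> r p v"
  shows "shapley \<beta> r p v = v"
proof -
  obtain \<mu> \<nu> where eq: "equilibrium \<beta> r p \<mu> \<nu>" and v: "v = discounted_reward \<beta> r p \<mu> \<nu>"
    using assms by (auto simp: value_vector_def)
  let ?G = "auxiliary_game \<beta> r p"
  have \<mu>: "mixed_strategy \<mu>" and \<nu>: "mixed_strategy \<nu>"
    using eq by (auto simp: equilibrium_def)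
  have vs: "mixed_ext (?G v s) (\<mu> s) (\<nu> s) = v $ s" for s
    using discounted_reward_eq[OF \<mu> \<nu>, of s] by (simp add: v)
  have dev1: "mixed_ext (?G v s) m (\<nu> s) \<le> v $ s" if m: "m \<in> mixed_actions" for s m
  proof (rule ccontr)
    assume better: "\<not> ?thesis"
    define \<mu>' where "\<mu>' = \<mu>(s := m)"
    define w where "w = discounted_reward \<beta> r p \<mu>' \<nu>"
    have \<mu>': "mixed_strategy \<mu>'" using \<mu> m by (simp add: \<mu>'_def mixed_strategy_def)
    have "v \<le> w" unfolding w_def
      by (rule le_discounted_reward[OF \<mu>' \<nu>]) (use better in \<open>simp add: \<mu>'_def vs\<close>)
    moreover have "w \<le> v" using eq \<mu>' by (simp add: equilibrium_def v w_def)
    ultimately have "w = v" by simp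
    then have "mixed_ext (?G v s) (\<mu>' s) (\<nu> s) = v $ s"
      using discounted_reward_eq[OF \<mu>' \<nu>, of s] by (simp add: w_def)
    with better show False by (simp add: \<mu>'_def)
  qed
  have dev2: "v $ s \<le> mixed_ext (?G v s) (\<mu> s) n" if n: "n \<in> mixed_actions" for s n
  proof (rule ccontr)
    assume better: "\<not> ?thesis"
    define \<nu>' where "\<nu>' = \<nu>(s := n)"
    define w where "w = discounted_reward \<beta> r p \<mu> \<nu>'"
    have \<nu>': "mixed_strategy \<nu>'" using \<nu> n by (simp add: \<nu>'_def mixed_strategy_def)
    have "w \<le> v" unfolding w_def
      by (rule discounted_reward_le[OF \<mu> \<nu>']) (use better in \<open>simp add: \<nu>'_def vs\<close>)
    moreover have "v \<le> w" using eq \<nu>' by (simp add: equilibrium_def v w_def)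
    ultimately have "w = v" by simp
    then have "mixed_ext (?G v s) (\<mu> s) (\<nu>' s) = v $ s"
      using discounted_reward_eq[OF \<mu> \<nu>', of s] by (simp add: w_def)
    with better show False by (simp add: \<nu>'_def)
  qed
  have sp: "saddle_point (?G v s) (\<mu> s) (\<nu> s)" for s
    using \<mu> \<nu> dev1 dev2 by (simp add: saddle_point_def mixed_strategy_def vs)
  show ?thesis
    by (simp add: vec_eq_iff shapley_def val_eq[OF sp] vs)
qed

end

theorem theorem1:
  fixes r :: "'s::finite \<Rightarrow> real poly poly"
    and p :: "'s \<Rightarrow> 's \<Rightarrow> real poly poly"
    and \<beta> :: real
  assumes "transition_polys p" and "0 \<le> \<beta>" and "\<beta> < 1"
  shows "(\<exists>!\<phi>. shapley \<beta> r p \<phi> = \<phi>) \<and>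
    (\<forall>\<phi>. shapley \<beta> r p \<phi> = \<phi> \<longrightarrow>
      (\<forall>\<mu> \<nu>. (\<forall>s. optimal1 (auxiliary_game \<beta> r p \<phi> s) (\<mu> s) \<and>
                  optimal2 (auxiliary_game \<beta> r p \<phi> s) (\<nu> s))
              \<longrightarrow> equilibrium \<beta> r p \<mu> \<nu>) \<and>
      (\<forall>v. value_vector \<beta> r p v \<longrightarrow> shapley \<beta> r p v = v) \<and>
      (\<exists>!v. value_vector \<beta> r p v) \<and>
      value_vector \<beta> r p \<phi>)"
proof -
  have unique: "\<exists>!\<phi>. shapley \<beta> r p \<phi> = \<phi>"
    using assms(2,3) by (rule unique_fixed_point_of_sup_contraction)
      (rule shapley_contraction[OF assms(1,2)])
  have value_fix: "shapley \<beta> r p v = v" if "value_vector \<beta> r p v" for v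
    using value_vector_is_fixed_point[OF assms that] .
  have fix_value: "value_vector \<beta> r p \<phi>" if fixpt: "shapley \<beta> r p \<phi> = \<phi>" for \<phi>
  proof -
    have "\<forall>s. \<exists>m n. saddle_point (auxiliary_game \<beta> r p \<phi> s) m n"
      using saddle_point_exists by blast
    from choice[OF this] obtain \<mu>
      where "\<forall>s. \<exists>n. saddle_point (auxiliary_game \<beta> r p \<phi> s) (\<mu> s) n" by blast
    from choice[OF this] obtain \<nu>
      where sp: "\<And>s. saddle_point (auxiliary_game \<beta> r p \<phi> s) (\<mu> s) (\<nu> s)" by blast
    show ?thesis
      using equilibrium_of_saddle_points[OF assms fixpt sp]
      unfolding value_vector_def by (intro exI[of _ \<mu>] exI[of _ \<nu>]) simp
  qed
  have unique_value: "\<exists>!v. value_vector \<beta> r p v"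
  proof -
    from unique obtain \<phi> where \<phi>: "shapley \<beta> r p \<phi> = \<phi>"
      and uniq: "\<And>v. shapley \<beta> r p v = v \<Longrightarrow> v = \<phi>"
      by (elim ex1E) blast
    show ?thesis
      by (rule ex1I[of _ \<phi>]) (rule fix_value[OF \<phi>], rule uniq, rule value_fix)
  qed
  have optimal: "equilibrium \<beta> r p \<mu> \<nu>"
    if "shapley \<beta> r p \<phi> = \<phi>"
      and "\<forall>s. optimal1 (auxiliary_game \<beta> r p \<phi> s) (\<mu> s) \<and> optimal2 (auxiliary_game \<beta> r p \<phi> s) (\<nu> s)"
    for \<phi> \<mu> \<nu>
  proof (rule equilibrium_of_saddle_points(1)[OF assms that(1)])
    show "saddle_point (auxiliary_game \<beta> r p \<phi> s) (\<mu> s) (\<nu> s)" for s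
      using that(2) by (intro saddle_point_of_optimal) auto
  qed
  show ?thesis
  proof (intro conjI allI impI)
    show "\<exists>!\<phi>. shapley \<beta> r p \<phi> = \<phi>" by (rule unique)
    show "\<exists>!v. value_vector \<beta> r p v" by (rule unique_value)
  qed (rule optimal value_fix fix_value; assumption)+
qed

end
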